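(* Let $\mathcal{B}_n^{(e)}$ and $\mathcal{B}_n^{(o)}$ denote the subsets of $\mathcal{B}_n$ (compositions of $n$ with all parts in $\{1,2\}$) consisting of those members whose capacity is even or odd, respectively, and let $w(n,k)$ be the number of members of $\mathcal{B}_n$ of capacity $k$. If $n\geq 0$, then $$|\mathcal{B}_n^{(e)}|-|\mathcal{B}_n^{(o)}|=\sum_{k=0}^n(-1)^k w(n,k)=2n-4+(-1)^nf_{n-6},$$ where $f_n$ is the $n$-th Fibonacci number, $f_{-m}$ for $m\geq 2$ is defined as $(-1)^mf_{m-2}$, and $f_{-1}=0$.
   Context: A composition of $n$ is a finite sequence of positive integers (parts) with sum $n$; $\mathcal{B}_n$ denotes the set of compositions of $n$ with all parts in $\{1,2\}$, and $\mathcal{B}_0$ consists of the empty composition only (with capacity $0$). The capacity $\mathrm{cap}(\pi)$ of a composition $\pi$ is the number of water cells of its bargraph (the unit cells outside the bargraph, whose $i$-th column has height $\pi_i$, that would hold water). For $\pi=\pi_1\cdots\pi_m\in\mathcal{B}_n$ this equals the number of indices $i$ with $\pi_i=1$ such that $\pi_a=2$ for some $a<i$ and $\pi_b=2$ for some $b>i$. The Fibonacci numbers are indexed by $f_0=f_1=1$ and $f_n=f_{n-1}+f_{n-2}$ for $n\ge 2$. *)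

theory Defs
  imports Main "HOL-Number_Theory.Fib"
begin

definition compositions :: "nat \<Rightarrow> nat list set" where
  "compositions n = {p. (\<forall>x\<in>set p. 0 < x) \<and> sum_list p = n}"

definition comps12 :: "nat \<Rightarrow> nat list set" where
  "comps12 n = {p \<in> compositions n. set p \<subseteq> {1, 2}}"

text \<open>
  The cell in column \<open>i\<close> (counted from 0) and row \<open>j\<close> (counted from 1) lies outside the
  bargraph iff \<open>p ! i < j\<close>.  It holds water iff, in addition, the bargraph reaches
  row \<open>j\<close> somewhere to its left and somewhere to its right.
\<close>
definition water_cells :: "nat list \<Rightarrow> (nat \<times> nat) set" where
  "water_cells p = {(i, j). i < length p \<and> p ! i < j \<and>
     (\<exists>a<i. j \<le> p ! a) \<and> (\<exists>b. i < b \<and> b < length p \<and> j \<le> p ! b)}"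

definition cap :: "nat list \<Rightarrow> nat" where
  "cap p = card (water_cells p)"

definition comps12_even :: "nat \<Rightarrow> nat list set" where
  "comps12_even n = {p \<in> comps12 n. even (cap p)}"

definition comps12_odd :: "nat \<Rightarrow> nat list set" where
  "comps12_odd n = {p \<in> comps12 n. odd (cap p)}"

definition num_cap :: "nat \<Rightarrow> nat \<Rightarrow> nat" where
  "num_cap n k = card {p \<in> comps12 n. cap p = k}"

text \<open>
  Fibonacci numbers with \<open>fibz 0 = fibz 1 = 1\<close>, hence shifted by one against \<^const>\<open>fib\<close>,
  and extended to negative indices by \<open>fibz (-1) = 0\<close> and
  \<open>fibz (-m) = (-1)^m * fibz (m - 2)\<close> for \<open>m \<ge> 2\<close>.
\<close>
definition fibz :: "int \<Rightarrow> int" where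
  "fibz i = (if 0 \<le> i then int (fib (nat i + 1))
          else if i = -1 then 0
          else (-1) ^ nat (-i) * int (fib (nat (-i - 2) + 1)))"

lemma fibz_0: "fibz 0 = 1" and fibz_1: "fibz 1 = 1"
  by (simp_all add: fibz_def numeral_2_eq_2)

lemma fibz_rec: "2 \<le> n \<Longrightarrow> fibz (int n) = fibz (int n - 1) + fibz (int n - 2)"
proof -
  assume "2 \<le> n"
  then obtain m where "n = Suc (Suc m)"
    by (metis add_2_eq_Suc le_Suc_ex)
  then show ?thesis
    by (simp add: fibz_def nat_add_distrib)
qed

lemma fibz_minus_1: "fibz (-1) = 0"
  by (simp add: fibz_def)

lemma fibz_neg: "2 \<le> m \<Longrightarrow> fibz (- int m) = (-1) ^ m * fibz (int m - 2)"
  by (simp add: fibz_def)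

lemma finite_compositions: "finite (compositions n)"
proof (rule finite_subset)
  have "length p \<le> sum_list p" if "\<forall>x\<in>set p. 0 < x" for p :: "nat list"
    using that by (induction p) auto
  then show "compositions n \<subseteq> {p. set p \<subseteq> {..n} \<and> length p \<le> n}"
    by (auto simp: compositions_def dest: member_le_sum_list)
  show "finite {p. set p \<subseteq> {..n} \<and> length p \<le> n}"
    by (rule finite_lists_length_le) simp
qed

lemma comps12_0: "comps12 0 = {[]}"
proof -
  have "p = []" if "p \<in> comps12 0" for p
    using that by (cases p) (auto simp: comps12_def compositions_def)
  then show ?thesis
    by (auto simp: comps12_def compositions_def)
qed

lemma cap_comps12:
  assumes "p \<in> comps12 n"
  shows "cap p = card {i. i < length p \<and> p ! i = 1 \<and>
    (\<exists>a<i. p ! a = 2) \<and> (\<exists>b. i < b \<and> b < length p \<and> p ! b = 2)}"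
    (is "_ = card ?I")
proof -
  have *: "p ! i = 1 \<or> p ! i = 2" if "i < length p" for i
    using assms nth_mem[OF that] unfolding comps12_def by blast
  have "water_cells p = (\<lambda>i. (i, 2)) ` ?I"
  proof (intro equalityI subsetI)
    fix c assume "c \<in> water_cells p"
    then obtain i j a b where c: "c = (i, j)" "i < length p" "p ! i < j"
      "a < i" "j \<le> p ! a" "i < b" "b < length p" "j \<le> p ! b"
      by (auto simp: water_cells_def)
    then have "p ! i = 1" "j = 2" "p ! a = 2" "p ! b = 2"
      using *[of i] *[of a] *[of b] by auto
    with c show "c \<in> (\<lambda>i. (i, 2)) ` ?I" by auto
  qed (auto simp: water_cells_def)
  then show ?thesis
    by (simp add: cap_def card_image inj_on_def)
qed

end

theory Submission
  imports Defs
begin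

text \<open>
  All three quantities are the signed sum \<open>A n = (\<Sum>p\<in>comps12 n. (-1) ^ cap p)\<close>, and this sum is
  computed by removing parts from the two ends of a composition.

  A smallest part at either end neither holds water nor supports any, so it can be dropped without
  changing the capacity (\<open>cap_Cons_least\<close>, \<open>cap_snoc_least\<close>).  Splitting by the first part therefore
  gives \<open>A (n + 2) = A (n + 1) + B n\<close>, where \<open>B n\<close> is the signed sum over the compositions \<open>2 # p\<close>
  with \<open>p \<in> comps12 n\<close>.  Splitting these by their last part gives
  \<open>B (n + 2) = B (n + 1) + C n\<close>, where \<open>C n\<close> is the signed sum over the compositions \<open>2 # p @ [2]\<close>.

  Between two walls of height 2 every part 1 of \<open>p\<close> holds exactly one cell of water
  (\<open>cap_between_twos\<close>), and the number of parts 1 in a composition of \<open>n\<close> into parts 1 and 2 has the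
  parity of \<open>n\<close>.  All terms of \<open>C n\<close> thus have the same sign, and \<open>C n = (-1) ^ n * f n\<close> because the
  compositions themselves are counted by the Fibonacci numbers.

  It remains to sum twice.  The Fibonacci recurrence holds at all integer indices (\<open>fibz_rec_int\<close>),
  so that \<open>(-1) ^ n * f i = (-1) ^ (n + 2) * f (i - 1) - (-1) ^ (n + 1) * f (i - 2)\<close>.  Hence
  \<open>(-1) ^ n * f n\<close> is a difference of two consecutive values of \<open>(-1) ^ n * f (n - 3)\<close>, and these in
  turn are differences of consecutive values of \<open>(-1) ^ n * f (n - 6)\<close>: each summation lowers the
  index by 3.  The initial values fix the remaining terms, giving
  \<open>B n = 2 + (-1) ^ n * f (n - 3)\<close> and \<open>A n = 2 * n - 4 + (-1) ^ n * f (n - 6)\<close>.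
\<close>

section \<open>Fibonacci numbers at integer indices\<close>

lemma fibz_rec_int: "fibz i = fibz (i - 1) + fibz (i - 2)"
proof -
  consider (large) "2 \<le> i" | (one) "i = 1" | (zero) "i = 0" | (minus_one) "i = -1"
    | (small) "i \<le> -2" by linarith
  then show ?thesis
  proof cases
    case large
    then show ?thesis using fibz_rec[of "nat i"] by simp
  next
    case small
    define m where "m = nat (- i - 2)"
    have i: "i = - int m - 2" using small by (simp add: m_def)
    have "nat (2 + int m) = m + 2" "nat (3 + int m) = m + 3" "nat (4 + int m) = m + 4"
      "nat (1 + int m) = m + 1" "nat (int m + 3) = m + 3" "nat (int m + 4) = m + 4"
      by simp_all
    then show ?thesis by (simp add: i fibz_def eval_nat_numeral algebra_simps)
  qed (simp_all add: fibz_def eval_nat_numeral)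
qed

section \<open>Splitting off the first or the last part\<close>

lemma finite_comps12: "finite (comps12 n)"
  by (rule finite_subset[OF _ finite_compositions[of n]]) (auto simp: comps12_def)

lemma comps12_iff: "p \<in> comps12 n \<longleftrightarrow> set p \<subseteq> {1, 2} \<and> sum_list p = n"
  by (auto simp: comps12_def compositions_def)

lemma comps12_1: "comps12 (Suc 0) = {[1]}"
proof -
  have "p = [1]" if "p \<in> comps12 (Suc 0)" for p
  proof (cases p)
    case Nil
    then show ?thesis using that by (simp add: comps12_iff)
  next
    case (Cons x q)
    then have "x = 1" "q \<in> comps12 0" using that by (auto simp: comps12_iff)
    then show ?thesis using Cons comps12_0 by simp
  qed
  then show ?thesis by (auto simp: comps12_iff)
qed

lemma comps12_Suc_Suc:
  "comps12 (Suc (Suc n)) = (#) 1 ` comps12 (Suc n) \<union> (#) 2 ` comps12 n"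
proof (intro equalityI subsetI)
  fix p assume p: "p \<in> comps12 (Suc (Suc n))"
  then obtain x q where "p = x # q" by (cases p) (auto simp: comps12_iff)
  then show "p \<in> (#) 1 ` comps12 (Suc n) \<union> (#) 2 ` comps12 n"
    using p by (auto simp: comps12_iff)
qed (auto simp: comps12_iff)

lemma sum_comps12_Cons:
  fixes g :: "nat list \<Rightarrow> int"
  shows "(\<Sum>p\<in>comps12 (Suc (Suc n)). g p) =
    (\<Sum>p\<in>comps12 (Suc n). g (1 # p)) + (\<Sum>p\<in>comps12 n. g (2 # p))"
proof -
  have "(\<Sum>p\<in>comps12 (Suc (Suc n)). g p) =
    (\<Sum>p\<in>(#) 1 ` comps12 (Suc n). g p) + (\<Sum>p\<in>(#) 2 ` comps12 n. g p)"
    unfolding comps12_Suc_Suc by (rule sum.union_disjoint) (auto simp: finite_comps12)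
  then show ?thesis by (simp add: sum.reindex o_def)
qed

lemma sum_comps12_rev:
  fixes g :: "nat list \<Rightarrow> int"
  shows "(\<Sum>p\<in>comps12 n. g (rev p)) = (\<Sum>p\<in>comps12 n. g p)"
  by (rule sum.reindex_bij_witness[of _ rev rev]) (auto simp: comps12_iff sum_list_rev)

lemma sum_comps12_snoc:
  fixes g :: "nat list \<Rightarrow> int"
  shows "(\<Sum>p\<in>comps12 (Suc (Suc n)). g p) =
    (\<Sum>p\<in>comps12 (Suc n). g (p @ [1])) + (\<Sum>p\<in>comps12 n. g (p @ [2]))"
  using sum_comps12_Cons[of "\<lambda>p. g (rev p)" n]
    sum_comps12_rev[of g "Suc (Suc n)"]
    sum_comps12_rev[of "\<lambda>p. g (p @ [1])" "Suc n"]
    sum_comps12_rev[of "\<lambda>p. g (p @ [2])" n]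
  by simp

lemma card_comps12: "int (card (comps12 n)) = fibz (int n)"
proof (induction n rule: fib.induct)
  case 1
  then show ?case by (simp add: comps12_0 fibz_0)
next
  case 2
  then show ?case by (simp add: comps12_1[simplified] fibz_1)
next
  case (3 n)
  then show ?case
    using sum_comps12_Cons[of "\<lambda>_. 1" n] fibz_rec_int[of "int (Suc (Suc n))"]
    by (simp add: algebra_simps)
qed

section \<open>Capacity and the two end parts\<close>

text \<open>
  A cell outside the bargraph lies above its own column; if that column is no lower than the first
  one, the first column cannot be the left wall of the cell.
\<close>
lemma cap_Cons_least:
  assumes "\<forall>y\<in>set q. x \<le> y"
  shows "cap (x # q) = cap q"
proof -
  have "water_cells (x # q) = (\<lambda>(i, j). (Suc i, j)) ` water_cells q"
  proof (intro equalityI subsetI)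
    fix c assume "c \<in> water_cells (x # q)"
    then obtain i j a b where c: "c = (i, j)" "i < Suc (length q)" "(x # q) ! i < j"
      "a < i" "j \<le> (x # q) ! a" "i < b" "b < Suc (length q)" "j \<le> (x # q) ! b"
      by (auto simp: water_cells_def)
    obtain i' b' where ib: "i = Suc i'" "b = Suc b'"
      using c by (cases i; cases b) auto
    then have "x \<le> q ! i'" using assms c by simp
    then obtain a' where a: "a = Suc a'" using c ib by (cases a) auto
    have "(i', j) \<in> water_cells q"
      using c ib a unfolding water_cells_def by auto
    then show "c \<in> (\<lambda>(i, j). (Suc i, j)) ` water_cells q"
      using c(1) ib(1) by force
  next
    fix c assume "c \<in> (\<lambda>(i, j). (Suc i, j)) ` water_cells q"
    then obtain i j a b where c: "c = (Suc i, j)" "i < length q" "q ! i < j"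
      "a < i" "j \<le> q ! a" "i < b" "b < length q" "j \<le> q ! b"
      by (auto simp: water_cells_def)
    have "\<exists>a<Suc i. j \<le> (x # q) ! a" using c by (intro exI[of _ "Suc a"]) simp
    moreover have "\<exists>b. Suc i < b \<and> b < length (x # q) \<and> j \<le> (x # q) ! b"
      using c by (intro exI[of _ "Suc b"]) simp
    ultimately show "c \<in> water_cells (x # q)"
      using c by (simp add: water_cells_def)
  qed
  then show ?thesis by (simp add: cap_def card_image inj_on_def split_def prod_eq_iff)
qed

lemma cap_snoc_least:
  assumes "\<forall>y\<in>set q. x \<le> y"
  shows "cap (q @ [x]) = cap q"
proof -
  have "water_cells (q @ [x]) = water_cells q"
  proof (intro equalityI subsetI)
    fix c assume "c \<in> water_cells (q @ [x])"
    then obtain i j a b where c: "c = (i, j)" "(q @ [x]) ! i < j"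
      "a < i" "j \<le> (q @ [x]) ! a" "i < b" "b < Suc (length q)" "j \<le> (q @ [x]) ! b"
      by (auto simp: water_cells_def)
    then have i: "i < length q" by simp
    then have "x \<le> q ! i" using assms by simp
    then have "b \<noteq> length q" using c i by (auto simp: nth_append)
    then have "b < length q" using c by simp
    then show "c \<in> water_cells q"
      using c i by (auto simp: water_cells_def nth_append)
  next
    fix c assume "c \<in> water_cells q"
    then obtain i j a b where c: "c = (i, j)" "i < length q" "q ! i < j"
      "a < i" "j \<le> q ! a" "i < b" "b < length q" "j \<le> q ! b"
      by (auto simp: water_cells_def)
    have "\<exists>a<i. j \<le> (q @ [x]) ! a"
      using c by (intro exI[of _ a]) (simp add: nth_append)
    moreover have "\<exists>b. i < b \<and> b < length (q @ [x]) \<and> j \<le> (q @ [x]) ! b"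
      using c by (intro exI[of _ b]) (simp add: nth_append)
    ultimately show "c \<in> water_cells (q @ [x])"
      using c by (simp add: water_cells_def nth_append)
  qed
  then show ?thesis by (simp add: cap_def)
qed

lemma cap_between_twos:
  assumes "set q \<subseteq> {1, 2}"
  shows "cap (2 # q @ [2]) = count_list q 1"
proof -
  let ?p = "2 # q @ [2]"
  have "?p \<in> comps12 (sum_list ?p)" using assms by (simp add: comps12_iff)
  then have "cap ?p = card {i. i < length ?p \<and> ?p ! i = 1 \<and>
    (\<exists>a<i. ?p ! a = 2) \<and> (\<exists>b. i < b \<and> b < length ?p \<and> ?p ! b = 2)}"
    by (rule cap_comps12)
  also have "{i. i < length ?p \<and> ?p ! i = 1 \<and>
    (\<exists>a<i. ?p ! a = 2) \<and> (\<exists>b. i < b \<and> b < length ?p \<and> ?p ! b = 2)} =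
    Suc ` {i. i < length q \<and> q ! i = 1}" (is "?I = _")
  proof (intro equalityI subsetI)
    fix i assume i: "i \<in> ?I"
    then obtain k where k: "i = Suc k" by (cases i) auto
    then have "k < length q" using i by (cases "k = length q") auto
    then show "i \<in> Suc ` {i. i < length q \<and> q ! i = 1}"
      using i k by (auto simp: nth_append)
  next
    fix i assume "i \<in> Suc ` {i. i < length q \<and> q ! i = 1}"
    then obtain k where "i = Suc k" "k < length q" "q ! k = 1" by blast
    then show "i \<in> ?I"
      by (auto simp: nth_append intro: exI[of _ 0] exI[of _ "Suc (length q)"])
  qed
  also have "card (Suc ` {i. i < length q \<and> q ! i = 1}) = count_list q 1"
    by (simp add: card_image count_list_eq_length_filter length_filter_conv_card eq_commute)
  finally show ?thesis .
qed

lemma cap_le: "cap p \<le> n" if "p \<in> comps12 n"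
proof -
  have "cap p \<le> card {..<length p}"
    unfolding cap_comps12[OF that] by (rule card_mono) auto
  also have "\<dots> \<le> sum_list p"
  proof -
    have "\<forall>x\<in>set p. 1 \<le> x" using that by (auto simp: comps12_iff)
    then show ?thesis by (induction p) auto
  qed
  finally show ?thesis using that by (simp add: comps12_iff)
qed

section \<open>Signed sums\<close>

text \<open>
  The parts 2 do not affect the parity of the sum, so the number of parts 1 is congruent to the sum
  modulo 2.
\<close>
lemma minus_one_power_ones:
  assumes "p \<in> comps12 n"
  shows "(-1 :: int) ^ count_list p 1 = (-1) ^ n"
proof -
  have "set p \<subseteq> {1, 2} \<Longrightarrow> (-1 :: int) ^ count_list p 1 = (-1) ^ sum_list p"
    by (induction p) auto
  then show ?thesis using assms by (simp add: comps12_iff)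
qed

lemma signed_sum_between_twos:
  "(\<Sum>p\<in>comps12 n. (-1 :: int) ^ cap (2 # p @ [2])) = (-1) ^ n * fibz (int n)"
proof -
  have "(\<Sum>p\<in>comps12 n. (-1 :: int) ^ cap (2 # p @ [2])) = (\<Sum>p\<in>comps12 n. (-1) ^ n)"
  proof (rule sum.cong)
    fix p assume "p \<in> comps12 n"
    then show "(-1 :: int) ^ cap (2 # p @ [2]) = (-1) ^ n"
      using cap_between_twos[of p] minus_one_power_ones[of p n] by (simp add: comps12_iff)
  qed simp
  then show ?thesis using card_comps12[of n] by simp
qed

lemma signed_sum_after_two:
  "(\<Sum>p\<in>comps12 n. (-1 :: int) ^ cap (2 # p)) = 2 + (-1) ^ n * fibz (int n - 3)"
proof (induction n rule: fib.induct)
  case 1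
  have "cap [2] = 0" using cap_Cons_least[of "[]" 2] by (simp add: cap_def water_cells_def)
  then show ?case by (simp add: comps12_0 fibz_def)
next
  case 2
  have "cap [2, 1] = cap [2]" using cap_snoc_least[of "[2]" 1] by simp
  also have "\<dots> = 0" using cap_Cons_least[of "[]" 2] by (simp add: cap_def water_cells_def)
  finally show ?case by (simp add: comps12_1[simplified] fibz_def)
next
  case (3 n)
  have "(\<Sum>p\<in>comps12 (Suc n). (-1 :: int) ^ cap (2 # p @ [1])) =
    (\<Sum>p\<in>comps12 (Suc n). (-1) ^ cap (2 # p))"
  proof (rule sum.cong)
    fix p assume "p \<in> comps12 (Suc n)"
    then have "\<forall>y\<in>set (2 # p). 1 \<le> y" by (auto simp: comps12_iff)
    then show "(-1 :: int) ^ cap (2 # p @ [1]) = (-1) ^ cap (2 # p)"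
      using cap_snoc_least[of "2 # p" 1] by simp
  qed simp
  then show ?case
    using sum_comps12_snoc[of "\<lambda>p. (-1) ^ cap (2 # p)" n] signed_sum_between_twos[of n] "3.IH"
      fibz_rec_int[of "int n"] fibz_rec_int[of "int n - 1"]
    by (simp add: algebra_simps)
qed

lemma signed_sum_comps12:
  "(\<Sum>p\<in>comps12 n. (-1 :: int) ^ cap p) = 2 * int n - 4 + (-1) ^ n * fibz (int n - 6)"
proof (induction n rule: fib.induct)
  case 1
  then show ?case by (simp add: comps12_0 fibz_def cap_def water_cells_def eval_nat_numeral)
next
  case 2
  have "cap [1] = 0" using cap_Cons_least[of "[]" 1] by (simp add: cap_def water_cells_def)
  then show ?case by (simp add: comps12_1[simplified] fibz_def eval_nat_numeral)
next
  case (3 n)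
  have "(\<Sum>p\<in>comps12 (Suc n). (-1 :: int) ^ cap (1 # p)) = (\<Sum>p\<in>comps12 (Suc n). (-1) ^ cap p)"
  proof (rule sum.cong)
    fix p assume "p \<in> comps12 (Suc n)"
    then have "\<forall>y\<in>set p. 1 \<le> y" by (auto simp: comps12_iff)
    then show "(-1 :: int) ^ cap (1 # p) = (-1) ^ cap p"
      using cap_Cons_least[of p 1] by simp
  qed simp
  then show ?case
    using sum_comps12_Cons[of "\<lambda>p. (-1) ^ cap p" n] signed_sum_after_two[of n] "3.IH"
      fibz_rec_int[of "int n - 3"]
    by (simp add: algebra_simps)
qed

lemma even_minus_odd_eq_signed_sum:
  "int (card (comps12_even n)) - int (card (comps12_odd n)) = (\<Sum>p\<in>comps12 n. (-1) ^ cap p)"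
proof -
  have split: "comps12 n = comps12_even n \<union> comps12_odd n"
    by (auto simp: comps12_even_def comps12_odd_def)
  have "finite (comps12_even n)" "finite (comps12_odd n)"
    using finite_comps12[of n] by (simp_all add: comps12_even_def comps12_odd_def)
  moreover have "comps12_even n \<inter> comps12_odd n = {}"
    by (auto simp: comps12_even_def comps12_odd_def)
  ultimately have "(\<Sum>p\<in>comps12 n. (-1 :: int) ^ cap p) =
    (\<Sum>p\<in>comps12_even n. (-1) ^ cap p) + (\<Sum>p\<in>comps12_odd n. (-1) ^ cap p)"
    unfolding split by (rule sum.union_disjoint)
  also have "\<dots> = (\<Sum>p\<in>comps12_even n. 1) + (\<Sum>p\<in>comps12_odd n. -1)"
    by (intro arg_cong2[where f = "(+)"] sum.cong) (auto simp: comps12_even_def comps12_odd_def)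
  finally show ?thesis by simp
qed

lemma sum_num_cap_eq_signed_sum:
  "(\<Sum>k=0..n. (-1) ^ k * int (num_cap n k)) = (\<Sum>p\<in>comps12 n. (-1) ^ cap p)"
proof -
  have "(\<Sum>p\<in>comps12 n. (-1 :: int) ^ cap p) =
    (\<Sum>k=0..n. \<Sum>p\<in>{p \<in> comps12 n. cap p = k}. (-1) ^ cap p)"
    by (rule sum.group[symmetric]) (auto simp: finite_comps12 cap_le)
  also have "\<dots> = (\<Sum>k=0..n. (-1) ^ k * int (num_cap n k))"
    by (intro sum.cong) (simp_all add: num_cap_def)
  finally show ?thesis by simp
qed

theorem theorem3:
  fixes n :: nat
  shows "int (card (comps12_even n)) - int (card (comps12_odd n)) = (\<Sum>k=0..n. (-1) ^ k * int (num_cap n k)) \<and>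
    (\<Sum>k=0..n. (-1) ^ k * int (num_cap n k)) = 2 * int n - 4 + (-1) ^ n * fibz (int n - 6)"
  by (simp add: even_minus_odd_eq_signed_sum sum_num_cap_eq_signed_sum signed_sum_comps12)

end
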